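(* If $F$ is a partially marked forest, then $\iota_{\rm g}(F)\le \iota_{\rm g}'(F)$.
   Context: All graphs are finite and simple; $N[x]$ is the closed neighborhood of $x$. A partially marked graph $G|A$ is a graph $G$ with a set $A\subseteq V(G)$ of marked vertices such that $G-A$ has no isolated vertices. The isolation game on $G|A$: Dominator and Staller alternately choose vertices. A marked set $M$ is maintained, initially $M=A$. A vertex $x$ may be chosen only if $N[x]\not\subseteq M$. When $x$ is chosen, $M$ is replaced by $M\cup N[x]\cup U$, where $U$ is the set of isolated vertices of $G-(M\cup N[x])$. The game ends when every vertex is marked. Dominator wants to minimize the number of chosen vertices, Staller to maximize it. $\iota_{\rm g}(G|A)$ (resp. $\iota_{\rm g}'(G|A)$) is the number of chosen vertices under optimal play when Dominator (resp. Staller) moves first. A partially marked forest is a partially marked graph whose underlying graph is a forest (with $A=\emptyset$ this is the ordinary isolation game on a forest, i.e. the game that ends when the unchosen-and-undominated vertices form an independent set). *)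

theory Defs
  imports "Graph_Theory.Digraph_Component"
begin

text \<open>
  Finite simple graphs are the locale \<^locale>\<open>graph\<close>: finite, loop-free, symmetric digraphs without
  parallel arcs.  Each undirected edge is a pair of opposite arcs.
\<close>

definition closed_nbhd :: "('a, 'b) pre_digraph \<Rightarrow> 'a \<Rightarrow> 'a set" where
  "closed_nbhd G x = insert x {y. x \<rightarrow>\<^bsub>G\<^esub> y}"

definition isolated_verts :: "('a, 'b) pre_digraph \<Rightarrow> 'a set" where
  "isolated_verts G = {v \<in> verts G. \<nexists>u. v \<rightarrow>\<^bsub>G\<^esub> u}"

definition delete_verts :: "('a, 'b) pre_digraph \<Rightarrow> 'a set \<Rightarrow> ('a, 'b) pre_digraph" where
  "delete_verts G S = G \<restriction> (verts G - S)"

text \<open>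
  The library constant \<^const>\<open>forest\<close> also excludes directed cycles of length 2, which every edge
  of a symmetric digraph forms; it therefore cannot be used here.  In a simple graph the undirected
  cycles are exactly the directed cycles of length at least 3.
\<close>

definition undirected_forest :: "('a, 'b) pre_digraph \<Rightarrow> bool" where
  "undirected_forest G \<longleftrightarrow> \<not> (\<exists>p. pre_digraph.cycle G p \<and> length p \<ge> 3)"

locale partially_marked_graph = graph G for G :: "('a, 'b) pre_digraph" (structure) +
  fixes A :: "'a set"
  assumes marked_subset: "A \<subseteq> verts G"
    and no_isolated: "isolated_verts (delete_verts G A) = {}"

locale partially_marked_forest = partially_marked_graph +
  assumes undirected_forest: "undirected_forest G"

datatype player = Dominator | Staller

context graph
begin

definition legal_moves :: "'a set \<Rightarrow> 'a set" where
  "legal_moves M = {x \<in> verts G. \<not> closed_nbhd G x \<subseteq> M}"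

definition mark :: "'a set \<Rightarrow> 'a \<Rightarrow> 'a set" where
  "mark M x = M \<union> closed_nbhd G x \<union> isolated_verts (delete_verts G (M \<union> closed_nbhd G x))"

lemma closed_nbhd_subset: "x \<in> verts G \<Longrightarrow> closed_nbhd G x \<subseteq> verts G"
  by (auto simp: closed_nbhd_def)

lemma finite_legal_moves: "finite (legal_moves M)"
  by (simp add: legal_moves_def)

lemma legal_moves_nonempty: "\<not> verts G \<subseteq> M \<Longrightarrow> legal_moves M \<noteq> {}"
  by (auto simp: legal_moves_def closed_nbhd_def)

lemma mark_decreases:
  assumes "x \<in> legal_moves M"
  shows "card (verts G - mark M x) < card (verts G - M)"
proof (rule psubset_card_mono)
  have "closed_nbhd G x \<subseteq> verts G" "\<not> closed_nbhd G x \<subseteq> M"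
    using assms closed_nbhd_subset by (auto simp: legal_moves_def)
  then show "verts G - mark M x \<subset> verts G - M"
    by (auto simp: mark_def)
qed simp

text \<open>
  The number of vertices chosen under optimal play from the position with marked set \<open>M\<close> in which
  \<open>p\<close> is to move.
\<close>

function game_value :: "player \<Rightarrow> 'a set \<Rightarrow> nat" where
  "game_value p M =
    (if verts G \<subseteq> M then 0
     else case p of
       Dominator \<Rightarrow> Suc (Min ((\<lambda>x. game_value Staller (mark M x)) ` legal_moves M))
     | Staller \<Rightarrow> Suc (Max ((\<lambda>x. game_value Dominator (mark M x)) ` legal_moves M)))"
  by pat_completeness auto
termination
  by (relation "measure (\<lambda>(p, M). card (verts G - M))") (auto simp: mark_decreases)

declare game_value.simps [simp del]

definition game_isolation_number :: "'a set \<Rightarrow> nat" where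
  "game_isolation_number A = game_value Dominator A"

definition game_isolation_number' :: "'a set \<Rightarrow> nat" where
  "game_isolation_number' A = game_value Staller A"

end

end

theory Submission
  imports Defs
begin

text \<open>
  Take a longest path among those that start in an unmarked vertex, and let \<open>v\<close>, \<open>u\<close>, \<open>x\<close> be its
  first three vertices, with \<open>x = u\<close> if there are only two.  Dominator opens with \<open>x\<close> and from then
  on compares the real game with an imagined game in which \<open>x\<close> was not played and Staller starts.
  By maximality of the path, every move that would mark \<open>v\<close> in the imagined game is illegal in the
  real one.  So Staller never marks \<open>v\<close> in the imagined game, and if the real game does not end
  earlier, then at some point an optimal imagined move of Dominator is illegal in it, at the latest
  when that move marks \<open>v\<close>.  This wasted move makes up for the opening move \<open>x\<close>: it leaves Staller to
  move in the imagined game and Dominator in the real one, where by induction going first does not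
  hurt Dominator.
\<close>

section \<open>Longest paths in forests\<close>

lemma (in wf_digraph) forest_apath_length_le_1:
  assumes "undirected_forest G" "apath u p v" "v \<rightarrow> u"
  shows "length p \<le> 1"
proof (rule ccontr)
  assume "\<not> length p \<le> 1"
  moreover obtain e where e: "e \<in> arcs G" "tail G e = v" "head G e = u"
    using assms(3) by auto
  moreover have "awalk v (e # p) v" "distinct (tl (awalk_verts v (e # p)))"
    using assms(2) e by (auto simp: apath_def awalk_Cons_iff)
  ultimately have "cycle (e # p)" "length (e # p) \<ge> 3"
    by (auto simp: cycle_def)
  with assms(1) show False
    by (auto simp: undirected_forest_def)
qed

primrec (in pre_digraph) next_vert :: "'a \<Rightarrow> 'b awalk \<Rightarrow> 'a" where
  "next_vert v [] = v"
| "next_vert v (e # p) = head G e"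

lemma (in wf_digraph) next_vert_in_awalk_verts:
  "apath v p a \<Longrightarrow> next_vert v p \<in> set (awalk_verts v p)"
  by (cases p) (auto simp: apath_Cons_iff hd_in_awalk_verts(2))

lemma (in wf_digraph) next_vert_closed_nbhd:
  "apath v p a \<Longrightarrow> next_vert v p \<in> closed_nbhd G v"
  by (cases p) (auto simp: apath_Cons_iff closed_nbhd_def dest: in_arcs_imp_in_arcs_ends)

lemma (in loopfree_digraph) forest_apath_Cons:
  assumes "undirected_forest G" "apath v p a" "w \<rightarrow> v" "w \<noteq> next_vert v p"
  obtains e where "head G e = v" "apath w (e # p) a"
proof -
  obtain e where e: "e \<in> arcs G" "tail G e = w" "head G e = v"
    using assms(3) by auto
  have "w \<notin> set (awalk_verts v p)"
  proof
    assume "w \<in> set (awalk_verts v p)"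
    then obtain q r where p: "p = q @ r" and q: "awalk v q w"
      using assms(2) awalk_decomp[of v p a w] by (auto simp: apath_def)
    then have "apath v q w"
      using assms(2) by (simp add: apath_append_iff)
    then have "length q \<le> 1"
      using forest_apath_length_le_1 assms(1,3) by blast
    then consider (empty) "q = []" | (single) f where "q = [f]"
      by (cases q) auto
    then show False
    proof cases
      case empty
      then show False
        using q e no_loops[of e] by (auto simp: awalk_Nil_iff)
    next
      case single
      then show False
        using q p assms(4) by (auto simp: awalk_Cons_iff awalk_Nil_iff)
    qed
  qed
  with assms(2) e that show thesis
    by (simp add: apath_Cons_iff)
qed

lemma (in fin_digraph) longest_apath_from:
  assumes "v\<^sub>0 \<in> S" "v\<^sub>0 \<in> verts G"
  obtains v p a where "v \<in> S" "apath v p a"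
    "\<forall>v'\<in>S. \<forall>p' a'. apath v' p' a' \<longrightarrow> length p' \<le> length p"
proof -
  let ?P = "\<lambda>(v, p, a). v \<in> S \<and> apath v p a" and ?len = "\<lambda>(v, p, a). length p"
  have "?P (v\<^sub>0, [], v\<^sub>0)"
    using assms by (simp add: apath_Nil_iff)
  moreover have "\<forall>z. ?P z \<longrightarrow> ?len z < card (verts G)"
    using length_apath_less by auto
  ultimately have "\<exists>z. ?P z \<and> (\<forall>z'. ?P z' \<longrightarrow> ?len z' \<le> ?len z)"
    by (rule ex_has_greatest_nat)
  then obtain v p a where "?P (v, p, a)" "\<forall>z'. ?P z' \<longrightarrow> ?len z' \<le> length p"
    by auto
  with that[of v p a] show thesis
    by auto
qed

context graph
begin

lemma forest_longest_apath_adj: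
  assumes "undirected_forest G"
    and longest: "\<forall>v\<in>S. \<forall>p a. apath v p a \<longrightarrow> length p \<le> n"
    and p: "apath v p a" "n \<le> length p" and w: "v \<rightarrow> w" "w \<noteq> next_vert v p"
  shows "w \<notin> S"
proof
  assume "w \<in> S"
  moreover obtain e where "apath w (e # p) a"
    using forest_apath_Cons[OF assms(1) p(1) graph_symmetric[OF w(1)] w(2)] .
  ultimately have "length (e # p) \<le> n"
    using longest by blast
  with p(2) show False by simp
qed

lemma forest_longest_apath_adj_adj:
  assumes "undirected_forest G"
    and longest: "\<forall>v\<in>S. \<forall>p a. apath v p a \<longrightarrow> length p \<le> n"
    and p: "apath v p a" "n \<le> Suc (length p)" and c: "v \<rightarrow> c" "c \<noteq> next_vert v p"
    and w: "c \<rightarrow> w" "w \<noteq> v"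
  shows "w \<notin> S"
proof -
  obtain e where e: "head G e = v" "apath c (e # p) a"
    using forest_apath_Cons[OF assms(1) p(1) graph_symmetric[OF c(1)] c(2)] .
  then show ?thesis
    using forest_longest_apath_adj[OF assms(1) longest e(2) _ w(1)] p(2) w(2) by simp
qed

lemma forest_outer_edge:
  assumes "undirected_forest G" "S \<subseteq> verts G" "S \<noteq> {}"
    and S_adj: "\<And>v. v \<in> S \<Longrightarrow> \<exists>u\<in>S. v \<rightarrow> u"
  obtains v u x where "v \<in> S" "v \<rightarrow> u" "x \<in> closed_nbhd G u" "x \<noteq> v"
    "\<And>c w. u \<rightarrow> c \<Longrightarrow> c \<noteq> x \<Longrightarrow> c \<rightarrow> w \<Longrightarrow> w \<noteq> u \<Longrightarrow> w \<notin> S"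
    "\<And>c w. v \<rightarrow> c \<Longrightarrow> c \<noteq> u \<Longrightarrow> c \<rightarrow> w \<Longrightarrow> w \<noteq> v \<Longrightarrow> w \<notin> S"
proof -
  obtain v p a where v: "v \<in> S" and p: "apath v p a"
    and longest: "\<forall>v'\<in>S. \<forall>p' a'. apath v' p' a' \<longrightarrow> length p' \<le> length p"
    using assms(2,3) longest_apath_from[of _ S] by blast
  obtain u where u: "u \<in> S" "v \<rightarrow> u"
    using S_adj[OF v] by blast
  have u_next: "u = next_vert v p"
    using forest_longest_apath_adj[OF assms(1) longest p order_refl u(2)] u(1) by blast
  then obtain e q where e: "p = e # q"
    using u(2) adj_not_same by (cases p) auto
  have q: "apath u q a" and v_notin: "v \<notin> set (awalk_verts u q)"
    using p u_next by (auto simp: e apath_Cons_iff)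
  show thesis
  proof
    show "v \<in> S" "v \<rightarrow> u" "next_vert u q \<in> closed_nbhd G u"
      using v u(2) next_vert_closed_nbhd[OF q] .
    show "next_vert u q \<noteq> v"
      using next_vert_in_awalk_verts[OF q] v_notin by blast
    show "w \<notin> S" if "u \<rightarrow> c" "c \<noteq> next_vert u q" "c \<rightarrow> w" "w \<noteq> u" for c w
      using forest_longest_apath_adj_adj[OF assms(1) longest q _ that] e by simp
    show "w \<notin> S" if "v \<rightarrow> c" "c \<noteq> u" "c \<rightarrow> w" "w \<noteq> v" for c w
      using forest_longest_apath_adj_adj[OF assms(1) longest p _ that(1) _ that(3,4)]
        that(2) u_next by simp
  qed
qed

end

section \<open>Marking\<close>

lemma (in wf_digraph) isolated_verts_delete_verts:
  "isolated_verts (delete_verts G S) = {v \<in> verts G - S. \<forall>u. v \<rightarrow> u \<longrightarrow> u \<in> S}"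
proof -
  have "v \<rightarrow>\<^bsub>G \<restriction> (verts G - S)\<^esub> u \<longleftrightarrow> v \<rightarrow> u \<and> v \<notin> S \<and> u \<notin> S" for u v
    by (auto simp: arcs_ends_conv induce_subgraph_def intro: rev_image_eqI)
  then show ?thesis
    by (auto simp: isolated_verts_def delete_verts_def)
qed

context graph
begin

definition saturated :: "'a set \<Rightarrow> bool" where
  "saturated M \<longleftrightarrow> isolated_verts (delete_verts G M) = {}"

lemma saturated_iff: "saturated M \<longleftrightarrow> (\<forall>v\<in>verts G - M. \<exists>u\<in>verts G - M. v \<rightarrow> u)"
  using adj_in_verts by (fastforce simp: saturated_def isolated_verts_delete_verts)

lemma mark_eq:
  "mark M x = M \<union> closed_nbhd G x \<union> {v \<in> verts G. \<forall>u. v \<rightarrow> u \<longrightarrow> u \<in> M \<union> closed_nbhd G x}"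
  by (auto simp: mark_def isolated_verts_delete_verts)

lemma subset_mark: "M \<subseteq> mark M x"
  by (auto simp: mark_def)

lemma closed_nbhd_subset_mark: "closed_nbhd G x \<subseteq> mark M x"
  by (auto simp: mark_def)

lemma mark_mono: "M \<subseteq> M' \<Longrightarrow> mark M x \<subseteq> mark M' x"
  by (auto simp: mark_eq)

lemma mark_absorb: "saturated M \<Longrightarrow> closed_nbhd G x \<subseteq> M \<Longrightarrow> mark M x = M"
  by (simp add: mark_def saturated_def Un_absorb2)

lemma mark_subset: "M \<subseteq> M' \<Longrightarrow> saturated M' \<Longrightarrow> closed_nbhd G x \<subseteq> M' \<Longrightarrow> mark M x \<subseteq> M'"
  using mark_mono mark_absorb by metis

lemma saturated_mark: "saturated (mark M x)"
  unfolding saturated_iff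
proof
  fix v assume v: "v \<in> verts G - mark M x"
  then obtain u where u: "v \<rightarrow> u" "u \<notin> M \<union> closed_nbhd G x"
    by (auto simp: mark_eq)
  moreover have "u \<rightarrow> v" "v \<notin> M \<union> closed_nbhd G x"
    using u v graph_symmetric by (auto simp: mark_eq)
  ultimately have "u \<in> verts G - mark M x"
    by (auto simp: mark_eq)
  with u show "\<exists>u\<in>verts G - mark M x. v \<rightarrow> u"
    by blast
qed

lemma legal_moves_antimono: "M \<subseteq> M' \<Longrightarrow> legal_moves M' \<subseteq> legal_moves M"
  by (auto simp: legal_moves_def)

lemma legal_moves_marked: "verts G \<subseteq> M \<Longrightarrow> legal_moves M = {}"
  using closed_nbhd_subset by (fastforce simp: legal_moves_def)

section \<open>Comparing games\<close>

lemma game_value_eq_0_iff: "game_value p M = 0 \<longleftrightarrow> verts G \<subseteq> M"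
  by (subst game_value.simps) (simp split: player.split)

lemma game_value_Dominator:
  "\<not> verts G \<subseteq> M \<Longrightarrow>
    game_value Dominator M = Suc (MIN x\<in>legal_moves M. game_value Staller (mark M x))"
  by (subst game_value.simps) simp

lemma game_value_Staller:
  "\<not> verts G \<subseteq> M \<Longrightarrow>
    game_value Staller M = Suc (MAX x\<in>legal_moves M. game_value Dominator (mark M x))"
  by (subst game_value.simps) simp

lemma game_value_Dominator_le:
  assumes "x \<in> legal_moves M"
  shows "game_value Dominator M \<le> Suc (game_value Staller (mark M x))"
proof -
  have "\<not> verts G \<subseteq> M"
    using assms legal_moves_marked by blast
  then show ?thesis
    using assms by (simp add: game_value_Dominator finite_legal_moves)
qed

lemma game_value_Staller_ge:
  assumes "x \<in> legal_moves M"
  shows "Suc (game_value Dominator (mark M x)) \<le> game_value Staller M"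
proof -
  have "\<not> verts G \<subseteq> M"
    using assms legal_moves_marked by blast
  then show ?thesis
    using assms by (simp add: game_value_Staller finite_legal_moves)
qed

lemma game_value_Dominator_attained:
  assumes "\<not> verts G \<subseteq> M"
  obtains x where "x \<in> legal_moves M"
    "game_value Dominator M = Suc (game_value Staller (mark M x))"
proof -
  let ?V = "(\<lambda>x. game_value Staller (mark M x)) ` legal_moves M"
  have "Min ?V \<in> ?V"
    using finite_legal_moves legal_moves_nonempty[OF assms] by (intro Min_in) auto
  then show thesis
    using that game_value_Dominator[OF assms] by auto
qed

lemma game_value_Staller_attained:
  assumes "\<not> verts G \<subseteq> M"
  obtains x where "x \<in> legal_moves M"
    "game_value Staller M = Suc (game_value Dominator (mark M x))"
proof -
  let ?V = "(\<lambda>x. game_value Dominator (mark M x)) ` legal_moves M"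
  have "Max ?V \<in> ?V"
    using finite_legal_moves legal_moves_nonempty[OF assms] by (intro Max_in) auto
  then show thesis
    using that game_value_Staller[OF assms] by auto
qed

text \<open>
  The imagination strategy: Dominator plays the real game \<open>R\<close> by copying optimal play from an
  imagined game \<open>I\<close>, and Staller's real moves are copied into \<open>I\<close>.
\<close>

lemma game_value_imagination:
  assumes "P I R"
    and subset: "\<And>I R. P I R \<Longrightarrow> I \<subseteq> R"
    and final: "\<And>I R p. P I R \<Longrightarrow> verts G \<subseteq> R \<Longrightarrow> k \<le> game_value p I"
    and copy: "\<And>I R x. P I R \<Longrightarrow> x \<in> legal_moves R \<Longrightarrow> P (mark I x) (mark R x)"
    and illegal: "\<And>I R x. P I R \<Longrightarrow> x \<in> legal_moves I \<Longrightarrow> closed_nbhd G x \<subseteq> R \<Longrightarrow>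
      \<not> verts G \<subseteq> R \<Longrightarrow> (\<exists>y\<in>legal_moves R. P (mark I x) (mark R y)) \<or>
        k + game_value Dominator R \<le> Suc (game_value Staller (mark I x))"
  shows "k + game_value p R \<le> game_value p I"
  using assms(1)
proof (induction "card (verts G - I)" arbitrary: I R p rule: less_induct)
  case less
  have IH: "k + game_value q (mark R y) \<le> game_value q (mark I x)"
    if "x \<in> legal_moves I" "P (mark I x) (mark R y)" for q x y
    using less.hyps[OF mark_decreases] that by blast
  show ?case
  proof (cases "verts G \<subseteq> R")
    case R: False
    then have I: "\<not> verts G \<subseteq> I"
      using subset less.prems by blast
    show ?thesis
    proof (cases p)
      case Dominator
      obtain x where x: "x \<in> legal_moves I"
        "game_value Dominator I = Suc (game_value Staller (mark I x))"
        using game_value_Dominator_attained[OF I] .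
      consider (move) y where "y \<in> legal_moves R" "P (mark I x) (mark R y)"
        | (lead) "k + game_value Dominator R \<le> Suc (game_value Staller (mark I x))"
        using copy[OF less.prems, of x] illegal[OF less.prems x(1) _ R] x(1)
        by (cases "x \<in> legal_moves R") (blast, auto simp: legal_moves_def)
      then show ?thesis
      proof cases
        case move
        then show ?thesis
          using IH[OF x(1) move(2), of Staller] game_value_Dominator_le[OF move(1)] x(2) Dominator
          by simp
      qed (simp add: x(2) Dominator)
    next
      case Staller
      obtain x where x: "x \<in> legal_moves R"
        "game_value Staller R = Suc (game_value Dominator (mark R x))"
        using game_value_Staller_attained[OF R] .
      have xI: "x \<in> legal_moves I"
        using x(1) legal_moves_antimono subset less.prems by blast
      show ?thesis
        using IH[OF xI copy[OF less.prems x(1)], of Dominator] game_value_Staller_ge[OF xI]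
          x(2) Staller by simp
    qed
  qed (use final less.prems game_value_eq_0_iff[of p R] in simp)
qed

lemma continuation_principle:
  assumes "M \<subseteq> M'" "saturated M'"
  shows "game_value p M' \<le> game_value p M"
proof -
  have "0 + game_value p M' \<le> game_value p M"
  proof (rule game_value_imagination[where P = "\<lambda>I R. I \<subseteq> R \<and> saturated R"])
    fix I R x
    assume "I \<subseteq> R \<and> saturated R" and "closed_nbhd G x \<subseteq> R" "\<not> verts G \<subseteq> R"
    then have "mark I x \<subseteq> R"
      by (simp add: mark_subset)
    moreover obtain y where "y \<in> legal_moves R"
      using legal_moves_nonempty[OF \<open>\<not> verts G \<subseteq> R\<close>] by blast
    ultimately show "(\<exists>y\<in>legal_moves R. mark I x \<subseteq> mark R y \<and> saturated (mark R y)) \<or>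
        0 + game_value Dominator R \<le> Suc (game_value Staller (mark I x))"
      using subset_mark saturated_mark by blast
  qed (use assms mark_mono saturated_mark in auto)
  then show ?thesis by simp
qed

text \<open>
  From a saturated position containing \<open>I\<close> but not \<open>v\<close>, a move can mark \<open>v\<close> only if it covers \<open>v\<close> or
  an unmarked neighbour of \<open>v\<close>.
\<close>

definition guarded :: "'a set \<Rightarrow> 'a \<Rightarrow> 'a set \<Rightarrow> bool" where
  "guarded I v R \<longleftrightarrow>
    (\<forall>t\<in>verts G. closed_nbhd G t \<inter> closed_nbhd G v \<subseteq> I \<or> closed_nbhd G t \<subseteq> R)"

lemma guarded_mono: "guarded I v R \<Longrightarrow> I \<subseteq> I' \<Longrightarrow> R \<subseteq> R' \<Longrightarrow> guarded I' v R'"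
  unfolding guarded_def by blast

lemma guarded_imp_mem: "guarded I v R \<Longrightarrow> v \<in> verts G - I \<Longrightarrow> v \<in> R"
  by (auto simp: guarded_def closed_nbhd_def)

lemma guarded_mark_illegal:
  assumes "guarded I v R" "saturated I" "v \<in> verts G - I" "v \<in> mark I t" "t \<in> verts G"
  shows "t \<notin> legal_moves R"
proof -
  have "\<not> closed_nbhd G t \<inter> closed_nbhd G v \<subseteq> I"
  proof (cases "v \<in> closed_nbhd G t")
    case True
    then show ?thesis
      using assms(3) by (auto simp: closed_nbhd_def)
  next
    case False
    obtain u where "v \<rightarrow> u" "u \<notin> I"
      using assms(2,3) by (auto simp: saturated_iff)
    moreover from this have "u \<in> closed_nbhd G t"
      using False assms(3,4) by (auto simp: mark_eq)
    ultimately show ?thesis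
      by (auto simp: closed_nbhd_def)
  qed
  then show ?thesis
    using assms(1,5) by (auto simp: guarded_def legal_moves_def)
qed

lemma game_value_less_if_guarded:
  assumes "saturated I" "saturated R" "I \<subseteq> R" "v \<in> verts G - I" "guarded I v R"
    and Dominator_first: "\<And>M. saturated M \<Longrightarrow> R \<subseteq> M \<Longrightarrow>
      game_value Dominator M \<le> game_value Staller M"
  shows "game_value p R < game_value p I"
proof -
  let ?P = "\<lambda>I' R'. saturated I' \<and> saturated R' \<and> I' \<subseteq> R' \<and> R \<subseteq> R' \<and>
    v \<in> verts G - I' \<and> guarded I' v R'"
  have "1 + game_value p R \<le> game_value p I"
  proof (rule game_value_imagination[where P = ?P])
    fix I' R' q
    assume "?P I' R'"
    then show "1 \<le> game_value q I'"
      using game_value_eq_0_iff[of q I'] by (auto simp: Suc_le_eq)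
  next
    fix I' R' x
    assume P: "?P I' R'" and "x \<in> legal_moves R'"
    then have "v \<notin> mark I' x"
      using guarded_mark_illegal[of I' v R' x] by (auto simp: legal_moves_def)
    moreover have "guarded (mark I' x) v (mark R' x)"
      using P guarded_mono subset_mark by blast
    ultimately show "?P (mark I' x) (mark R' x)"
      using P saturated_mark mark_mono subset_mark by blast
  next
    fix I' R' x
    assume P: "?P I' R'" and x: "closed_nbhd G x \<subseteq> R'"
    have "game_value Dominator R' \<le> game_value Staller R'"
      using P Dominator_first by blast
    also have "\<dots> \<le> game_value Staller (mark I' x)"
      using P x by (intro continuation_principle mark_subset) auto
    finally show "(\<exists>y\<in>legal_moves R'. ?P (mark I' x) (mark R' y)) \<or>
        1 + game_value Dominator R' \<le> Suc (game_value Staller (mark I' x))"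
      by simp
  qed (use assms in auto)
  then show ?thesis by simp
qed

lemma game_value_Dominator_le_Staller:
  assumes guarding_move: "\<And>M. saturated M \<Longrightarrow> \<not> verts G \<subseteq> M \<Longrightarrow>
      \<exists>v\<in>verts G - M. \<exists>x\<in>verts G. guarded M v (mark M x)"
    and "saturated M"
  shows "game_value Dominator M \<le> game_value Staller M"
  using assms(2)
proof (induction "card (verts G - M)" arbitrary: M rule: less_induct)
  case less
  show ?case
  proof (cases "verts G \<subseteq> M")
    case True
    then show ?thesis
      using game_value_eq_0_iff[of Dominator M] by simp
  next
    case False
    then obtain v x where v: "v \<in> verts G - M" and x: "x \<in> verts G"
      and guarded: "guarded M v (mark M x)"
      using guarding_move less.prems by blast
    have v_mark: "v \<in> mark M x"
      using guarded_imp_mem guarded v .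
    have "game_value Dominator M' \<le> game_value Staller M'"
      if "saturated M'" "mark M x \<subseteq> M'" for M'
    proof (rule less.hyps[OF psubset_card_mono])
      show "verts G - M' \<subset> verts G - M"
        using that(2) v v_mark subset_mark[of M x] by blast
    qed (use that(1) in auto)
    then have "Suc (game_value Staller (mark M x)) \<le> game_value Staller M"
      using game_value_less_if_guarded[OF less.prems saturated_mark subset_mark v guarded]
      by (simp add: Suc_le_eq)
    moreover have "x \<in> legal_moves M"
      using mark_absorb[OF less.prems] x v v_mark by (auto simp: legal_moves_def)
    ultimately show ?thesis
      using game_value_Dominator_le by (blast intro: order_trans)
  qed
qed

section \<open>Guarding moves in forests\<close>

lemma guardedI:
  assumes "closed_nbhd G v \<subseteq> M \<union> {u, v}"
    and "\<And>t. t \<in> closed_nbhd G u \<union> closed_nbhd G v \<Longrightarrow> closed_nbhd G t \<subseteq> R"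
  shows "guarded M v R"
  unfolding guarded_def
proof
  fix t
  show "closed_nbhd G t \<inter> closed_nbhd G v \<subseteq> M \<or> closed_nbhd G t \<subseteq> R"
  proof (cases "u \<in> closed_nbhd G t \<or> v \<in> closed_nbhd G t")
    case True
    then have "t \<in> closed_nbhd G u \<union> closed_nbhd G v"
      using graph_symmetric by (auto simp: closed_nbhd_def)
    then show ?thesis
      using assms(2) by blast
  qed (use assms(1) in blast)
qed

lemma guarded_mark:
  assumes "v \<rightarrow> u" "x \<in> closed_nbhd G u" "x \<noteq> v"
    and u_side: "\<And>c w. u \<rightarrow> c \<Longrightarrow> c \<noteq> x \<Longrightarrow> c \<rightarrow> w \<Longrightarrow> w \<noteq> u \<Longrightarrow> w \<in> M"
    and v_side: "\<And>c w. v \<rightarrow> c \<Longrightarrow> c \<noteq> u \<Longrightarrow> c \<rightarrow> w \<Longrightarrow> w \<noteq> v \<Longrightarrow> w \<in> M"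
  shows "guarded M v (mark M x)"
proof (rule guardedI)
  have uv: "u \<rightarrow> v"
    using assms(1) by (rule graph_symmetric)
  have ux: "u \<in> closed_nbhd G x"
    using assms(2) graph_symmetric by (auto simp: closed_nbhd_def)
  show "closed_nbhd G v \<subseteq> M \<union> {u, v}"
    using u_side[OF uv] assms(3) by (auto simp: closed_nbhd_def)
  have u_nbr: "closed_nbhd G c \<subseteq> mark M x" if "u \<rightarrow> c" for c
  proof (cases "c = x")
    case False
    have nbr: "w \<in> M \<union> closed_nbhd G x" if "c \<rightarrow> w" for w
      using u_side[OF \<open>u \<rightarrow> c\<close> False that] ux by blast
    then have "c \<in> mark M x"
      using \<open>u \<rightarrow> c\<close> adj_in_verts by (auto simp: mark_eq)
    then show ?thesis
      using nbr by (auto simp: closed_nbhd_def mark_def)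
  qed (simp add: closed_nbhd_subset_mark)
  have u_nbhd: "closed_nbhd G u \<subseteq> mark M x"
    using u_nbr ux closed_nbhd_subset_mark by (auto simp: closed_nbhd_def)
  have v_nbr: "closed_nbhd G c \<subseteq> mark M x" if "v \<rightarrow> c" for c
  proof (cases "c = u")
    case False
    have "w \<in> M \<union> {v}" if "c \<rightarrow> w" for w
      using v_side[OF \<open>v \<rightarrow> c\<close> False that] by blast
    then show ?thesis
      using u_nbr[OF uv] \<open>v \<rightarrow> c\<close> subset_mark by (auto simp: closed_nbhd_def)
  qed (simp add: u_nbhd)
  show "closed_nbhd G t \<subseteq> mark M x" if "t \<in> closed_nbhd G u \<union> closed_nbhd G v" for t
    using that u_nbhd u_nbr v_nbr u_nbr[OF uv] by (auto simp: closed_nbhd_def)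
qed

lemma forest_guarding_move:
  assumes "undirected_forest G" "saturated M" "\<not> verts G \<subseteq> M"
  shows "\<exists>v\<in>verts G - M. \<exists>x\<in>verts G. guarded M v (mark M x)"
proof -
  let ?S = "verts G - M"
  obtain v u x where v: "v \<in> ?S" and u: "v \<rightarrow> u" and x: "x \<in> closed_nbhd G u" "x \<noteq> v"
    and outer: "\<And>c w. u \<rightarrow> c \<Longrightarrow> c \<noteq> x \<Longrightarrow> c \<rightarrow> w \<Longrightarrow> w \<noteq> u \<Longrightarrow> w \<notin> ?S"
      "\<And>c w. v \<rightarrow> c \<Longrightarrow> c \<noteq> u \<Longrightarrow> c \<rightarrow> w \<Longrightarrow> w \<noteq> v \<Longrightarrow> w \<notin> ?S"
    using forest_outer_edge[OF assms(1), of ?S] assms(2,3) by (auto simp: saturated_iff)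
  have "guarded M v (mark M x)"
  proof (rule guarded_mark[OF u x])
    show "w \<in> M" if "u \<rightarrow> c" "c \<noteq> x" "c \<rightarrow> w" "w \<noteq> u" for c w
      using outer(1)[OF that] that(3) adj_in_verts by blast
    show "w \<in> M" if "v \<rightarrow> c" "c \<noteq> u" "c \<rightarrow> w" "w \<noteq> v" for c w
      using outer(2)[OF that] that(3) adj_in_verts by blast
  qed
  moreover have "x \<in> verts G"
    using u x(1) adj_in_verts by (auto simp: closed_nbhd_def)
  ultimately show ?thesis
    using v by blast
qed

end

theorem theorem4p2:
  fixes G :: "('a, 'b) pre_digraph" and A :: "'a set"
  assumes "partially_marked_forest G A"
  shows "graph.game_isolation_number G A \<le> graph.game_isolation_number' G A"
proof -
  interpret partially_marked_forest G A by (rule assms)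
  have "saturated A"
    using no_isolated by (simp add: saturated_def)
  with forest_guarding_move[OF undirected_forest] show ?thesis
    unfolding game_isolation_number_def game_isolation_number'_def
    by (rule game_value_Dominator_le_Staller)
qed

end
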